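(* There is a vector $\Delta\in\mathbb R^d$ such that $$w-w^\star=H(\phi-\phi^\star)+\nabla g(\phi^\star)^\top(\lambda-\lambda^\star)+\Delta,$$ with $\|\Delta\|_{H^{-1}}\le\frac14\|\phi-\phi^\star\|_H+L\,\|\phi-\phi^\star\|_H\,\|\lambda-\lambda^\star\|_W$, and moreover $$\|P_GH^{1/2}(\phi-\phi^\star)\|_2\le\frac L2\|\phi-\phi^\star\|_H^2.$$
   Context: Let $m\le d$ and $g=(g_1,\dots,g_m):\mathbb R^d\to\mathbb R^m$, each $g_i$ strongly convex and twice differentiable; $\Phi=\{x:g(x)\le0\}$; $\nabla g(x)\in\mathbb R^{m\times d}$ is the Jacobian. For $w^\star,w\in\mathbb R^d$ let $\phi^\star=\arg\max_{x\in\Phi}x^\top w^\star$, $\phi=\arg\max_{x\in\Phi}x^\top w$, with $g(\phi^\star)=g(\phi)=0$. $\lambda^\star,\lambda\in\mathbb R^m_{\ge0}$ are KKT multipliers: $w^\star=\nabla g(\phi^\star)^\top\lambda^\star$, $w=\nabla g(\phi)^\top\lambda$. $H=\sum_i\lambda^\star_i\nabla^2g_i(\phi^\star)$, positive definite; $\|x\|_M=\sqrt{x^\top Mx}$. $W=\nabla g(\phi^\star)H^{-1}\nabla g(\phi^\star)^\top$, invertible. $P_G=H^{-1/2}\nabla g(\phi^\star)^\top W^{-1}\nabla g(\phi^\star)H^{-1/2}$. Smoothness: (S1) $\|\{\nabla g(\phi)-\nabla g(\phi^\star)\}^\top\lambda^\star-H(\phi-\phi^\star)\|_{H^{-1}}\le\frac14\|\phi-\phi^\star\|_H$;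 (S2) there is $L>0$ with $\|W^{-1/2}\{\nabla g(x)-\nabla g(\phi^\star)\}H^{-1/2}\|_2\le L\|x-\phi^\star\|_H$ for all $x\in\mathbb R^d$. *)

theory Defs
  imports "HOL-Analysis.Analysis"
begin

text \<open>Strong convexity on the whole space: f - (mu/2)|x|^2 is convex for some mu > 0.\<close>
definition strongly_convex :: "('a::real_inner \<Rightarrow> real) \<Rightarrow> bool" where
  "strongly_convex f \<longleftrightarrow> (\<exists>\<mu>>0. convex_on UNIV (\<lambda>x. f x - \<mu> / 2 * (norm x)\<^sup>2))"

text \<open>Positive (semi)definite symmetric matrices.\<close>
definition pos_def :: "real^'n^'n \<Rightarrow> bool" where
  "pos_def A \<longleftrightarrow> transpose A = A \<and> (\<forall>x. x \<noteq> 0 \<longrightarrow> x \<bullet> (A *v x) > 0)"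

definition pos_semidef :: "real^'n^'n \<Rightarrow> bool" where
  "pos_semidef A \<longleftrightarrow> transpose A = A \<and> (\<forall>x. x \<bullet> (A *v x) \<ge> 0)"

text \<open>The (unique) symmetric positive semidefinite square root A^(1/2).\<close>
definition msqrt :: "real^'n^'n \<Rightarrow> real^'n^'n" where
  "msqrt A = (THE S. pos_semidef S \<and> S ** S = A)"

text \<open>The weighted norm |x|_M = sqrt(x^T M x).\<close>
definition mnorm :: "real^'n^'n \<Rightarrow> real^'n \<Rightarrow> real" where
  "mnorm M x = sqrt (x \<bullet> (M *v x))"

end

theory Submission
  imports Defs
begin

(* Write delta = phi - phi_star, G = grad g(phi_star) and G' = grad g(phi). By the KKT equations,
   w - w_star - H delta - G^T (lam - lam_star) is the sum of (G' - G)^T lam_star - H delta, which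
   (S1) controls, and (G' - G)^T (lam - lam_star). In the H^-1-norm the latter is the transpose of
   the operator W^-1/2 (G' - G) H^-1/2 of (S2) applied to W^1/2 (lam - lam_star), so its size is
   at most L |delta|_H |lam - lam_star|_W.

   P_G is the orthogonal projection onto the range of H^-1/2 G^T, hence
   |P_G H^1/2 delta| = |W^-1/2 G delta|. As g(phi) = g(phi_star) = 0, the vector G delta is minus
   the first-order Taylor remainder of g along the segment from phi_star to phi, and (S2) says that
   the Jacobian is Lipschitz along this segment in the norms involved, which bounds the remainder
   by L/2 |delta|_H^2.

   The square roots H^1/2 and W^1/2 come from the spectral theorem for symmetric matrices, proved
   by maximising the quadratic form on the unit sphere of the orthogonal complement of the
   eigenvectors found so far. *)

section \<open>Matrix inverses and positive semidefinite matrices\<close>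

lemma inner_matrix_vector_transpose:
  fixes M :: "real^'n^'m"
  shows "x \<bullet> (M *v y) = (transpose M *v x) \<bullet> y"
  by (simp add: dot_lmul_matrix)

lemma inner_symmetric_matrix_vector:
  fixes A :: "real^'n^'n"
  assumes "transpose A = A"
  shows "x \<bullet> (A *v y) = (A *v x) \<bullet> y"
  using inner_matrix_vector_transpose[of x A y] assms by simp

lemma matrix_inv_right:
  fixes A :: "real^'n^'n"
  assumes "invertible A"
  shows "A ** matrix_inv A = mat 1"
  using someI_ex[OF assms[unfolded invertible_def]] unfolding matrix_inv_def by auto

lemma matrix_inv_left:
  fixes A :: "real^'n^'n"
  assumes "invertible A"
  shows "matrix_inv A ** A = mat 1"
  using someI_ex[OF assms[unfolded invertible_def]] unfolding matrix_inv_def by auto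

lemma matrix_inv_cancel:
  fixes A :: "real^'n^'n"
  assumes "invertible A"
  shows matrix_inv_cancel_right: "A *v (matrix_inv A *v x) = x"
    and matrix_inv_cancel_left: "matrix_inv A *v (A *v x) = x"
  by (simp_all add: matrix_vector_mul_assoc matrix_inv_right[OF assms] matrix_inv_left[OF assms])

lemma matrix_inv_unique:
  fixes A X :: "real^'n^'n"
  assumes "X ** A = mat 1"
  shows "matrix_inv A = X"
proof -
  have "invertible A"
    using assms invertible_left_inverse by blast
  then have "X = X ** (A ** matrix_inv A)"
    by (simp add: matrix_inv_right)
  also have "\<dots> = matrix_inv A"
    using assms by (simp add: matrix_mul_assoc)
  finally show ?thesis by simp
qed

lemma matrix_inv_mult:
  fixes A B :: "real^'n^'n"
  assumes "invertible A" "invertible B"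
  shows "matrix_inv (A ** B) = matrix_inv B ** matrix_inv A"
proof (rule matrix_inv_unique)
  have "matrix_inv B ** matrix_inv A ** (A ** B) = matrix_inv B ** (matrix_inv A ** A) ** B"
    by (simp add: matrix_mul_assoc)
  then show "matrix_inv B ** matrix_inv A ** (A ** B) = mat 1"
    by (simp add: matrix_inv_left assms)
qed

lemma invertible_mult_left_factor:
  fixes A B :: "real^'n^'n"
  assumes "invertible (A ** B)"
  shows "invertible A"
  using matrix_inv_right[OF assms] invertible_right_inverse
  by (metis matrix_mul_assoc)

lemma symmetric_matrix_inv:
  fixes A :: "real^'n^'n"
  assumes "invertible A" "transpose A = A"
  shows "transpose (matrix_inv A) = matrix_inv A"
proof -
  have "transpose (matrix_inv A) ** A = transpose (A ** matrix_inv A)"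
    using assms(2) by (simp add: matrix_transpose_mul)
  also have "\<dots> = mat 1"
    by (simp add: matrix_inv_right[OF assms(1)] transpose_mat)
  finally show ?thesis
    by (rule matrix_inv_unique[symmetric])
qed

lemma pos_def_imp_pos_semidef:
  fixes A :: "real^'n^'n"
  assumes "pos_def A"
  shows "pos_semidef A"
  using assms unfolding pos_def_def pos_semidef_def
  by (metis inner_zero_left matrix_vector_mult_0_right order_le_less order_refl)

lemma pos_def_imp_invertible:
  fixes A :: "real^'n^'n"
  assumes "pos_def A"
  shows "invertible A"
proof -
  have "inj ((*v) A)"
  proof (rule injI)
    fix x y
    assume "A *v x = A *v y"
    then have "(x - y) \<bullet> (A *v (x - y)) = 0"
      by (simp add: matrix_vector_mult_diff_distrib)
    then show "x = y"
      using assms unfolding pos_def_def by (metis less_irrefl right_minus_eq)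
  qed
  then show ?thesis
    using matrix_left_invertible_injective invertible_left_inverse by blast
qed

lemma pos_semidef_matrix_inv:
  fixes A :: "real^'n^'n"
  assumes "pos_semidef A" "invertible A"
  shows "pos_semidef (matrix_inv A)"
  unfolding pos_semidef_def
proof (intro conjI allI)
  show "transpose (matrix_inv A) = matrix_inv A"
    using assms symmetric_matrix_inv unfolding pos_semidef_def by blast
  fix x
  have "x \<bullet> (matrix_inv A *v x) = (A *v (matrix_inv A *v x)) \<bullet> (matrix_inv A *v x)"
    by (simp add: matrix_inv_cancel_right[OF assms(2)])
  also have "\<dots> = (matrix_inv A *v x) \<bullet> (A *v (matrix_inv A *v x))"
    by (rule inner_commute)
  finally show "x \<bullet> (matrix_inv A *v x) \<ge> 0"
    using assms(1) unfolding pos_semidef_def by simp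
qed

lemma pos_semidef_congruence:
  fixes A :: "real^'n^'n" and G :: "real^'n^'m"
  assumes "pos_semidef A"
  shows "pos_semidef (G ** A ** transpose G)"
  unfolding pos_semidef_def
proof (intro conjI allI)
  show "transpose (G ** A ** transpose G) = G ** A ** transpose G"
    using assms unfolding pos_semidef_def by (simp add: matrix_transpose_mul matrix_mul_assoc)
  fix x
  have "x \<bullet> ((G ** A ** transpose G) *v x) = (transpose G *v x) \<bullet> (A *v (transpose G *v x))"
    by (simp add: inner_matrix_vector_transpose matrix_vector_mul_assoc[symmetric]
        del: transpose_matrix_vector)
  then show "x \<bullet> ((G ** A ** transpose G) *v x) \<ge> 0"
    using assms unfolding pos_semidef_def by simp
qed

section \<open>Spectral theorem and matrix square roots\<close>

definition orthonormal_eigenvectors :: "real^'n^'n \<Rightarrow> (real^'n) set \<Rightarrow> bool" where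
  "orthonormal_eigenvectors A B \<longleftrightarrow> finite B \<and> pairwise orthogonal B \<and>
     (\<forall>b\<in>B. norm b = 1 \<and> A *v b = (b \<bullet> (A *v b)) *\<^sub>R b)"

lemma quadratic_form_max_imp_eigenvector:
  fixes A :: "real^'n^'n"
  assumes sym: "transpose A = A" and "subspace S" and "v \<in> S" "A *v v \<in> S" "norm v = 1"
    and max: "\<And>z. z \<in> S \<Longrightarrow> z \<bullet> (A *v z) \<le> (v \<bullet> (A *v v)) * (z \<bullet> z)"
  shows "A *v v = (v \<bullet> (A *v v)) *\<^sub>R v"
proof (rule ccontr)
  \<comment> \<open>If r were nonzero, moving from v towards r would raise the Rayleigh quotient to first order.\<close>
  define \<mu> where "\<mu> = v \<bullet> (A *v v)"
  define r where "r = A *v v - \<mu> *\<^sub>R v"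
  define \<rho> where "\<rho> = r \<bullet> r"
  define c where "c = r \<bullet> (A *v r)"
  define k where "k = \<bar>\<mu> * \<rho> - c\<bar>"
  define t where "t = \<rho> / (k + 1)"
  assume "A *v v \<noteq> (v \<bullet> (A *v v)) *\<^sub>R v"
  then have "\<rho> > 0"
    unfolding \<rho>_def r_def \<mu>_def by simp
  have vv: "v \<bullet> v = 1"
    using \<open>norm v = 1\<close> by (simp add: norm_eq_1)
  have rv: "r \<bullet> v = 0"
  proof -
    have "v \<bullet> r = 0"
      unfolding r_def \<mu>_def using vv by (simp add: inner_diff_right)
    then show ?thesis by (simp add: inner_commute)
  qed
  have rAv: "r \<bullet> (A *v v) = \<rho>"
    unfolding \<rho>_def r_def using rv[unfolded r_def] by (simp add: inner_diff_right inner_diff_left)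
  have "r \<in> S"
    unfolding r_def using assms(2-4) by (simp add: subspace_diff subspace_scale)
  then have "v + t *\<^sub>R r \<in> S"
    using assms(2,3) by (simp add: subspace_add subspace_scale)
  from max[OF this]
  have "\<mu> + 2 * t * \<rho> + t\<^sup>2 * c \<le> \<mu> * (1 + t\<^sup>2 * \<rho>)"
    using vv rv rAv inner_symmetric_matrix_vector[OF sym, of v r]
    unfolding \<mu>_def c_def \<rho>_def
    by (simp add: matrix_vector_right_distrib matrix_vector_mult_scaleR inner_commute
        algebra_simps power2_eq_square)
  then have "t * (2 * \<rho>) \<le> t * (t * (\<mu> * \<rho> - c))"
    by (simp add: power2_eq_square algebra_simps)
  moreover have "t > 0"
    unfolding t_def k_def using \<open>\<rho> > 0\<close> by simp
  ultimately have "2 * \<rho> \<le> t * (\<mu> * \<rho> - c)"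
    by (simp add: mult_le_cancel_left_pos)
  also have "\<dots> \<le> t * k"
    unfolding k_def t_def using \<open>\<rho> > 0\<close> by (intro mult_left_mono) auto
  also have "\<dots> < \<rho>"
    unfolding t_def using \<open>\<rho> > 0\<close> by (simp add: field_simps k_def)
  finally show False
    using \<open>\<rho> > 0\<close> by simp
qed

lemma symmetric_matrix_eigenvector_orthogonal:
  fixes A :: "real^'n^'n"
  assumes sym: "transpose A = A" and B: "orthonormal_eigenvectors A B"
    and "y \<noteq> 0" "\<forall>b\<in>B. orthogonal b y"
  shows "\<exists>v. norm v = 1 \<and> (\<forall>b\<in>B. orthogonal b v) \<and> A *v v = (v \<bullet> (A *v v)) *\<^sub>R v"
proof -
  define S where "S = {x. \<forall>b\<in>B. orthogonal b x}"
  define K where "K = sphere 0 1 \<inter> S"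
  have "subspace S"
    unfolding S_def by (rule subspace_orthogonal_to_vectors)
  have "compact K"
    unfolding K_def by (intro compact_Int_closed compact_sphere closed_subspace \<open>subspace S\<close>)
  moreover have "y /\<^sub>R norm y \<in> K"
    using assms(3,4) unfolding K_def S_def by (auto simp: orthogonal_clauses)
  moreover have "continuous_on K (\<lambda>x. x \<bullet> (A *v x))"
    by (intro continuous_intros linear_continuous_on matrix_vector_mul_bounded_linear)
  ultimately obtain v where "v \<in> K" and vmax: "\<And>x. x \<in> K \<Longrightarrow> x \<bullet> (A *v x) \<le> v \<bullet> (A *v v)"
    using continuous_attains_sup[of K "\<lambda>x. x \<bullet> (A *v x)"] by blast
  then have "v \<in> S" "norm v = 1"
    unfolding K_def by auto
  have "A *v v \<in> S"
    unfolding S_def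
  proof (intro CollectI ballI)
    fix b
    assume "b \<in> B"
    then obtain \<mu> where "A *v b = \<mu> *\<^sub>R b"
      using B unfolding orthonormal_eigenvectors_def by blast
    then have "b \<bullet> (A *v v) = \<mu> * (b \<bullet> v)"
      by (simp add: inner_symmetric_matrix_vector[OF sym])
    then show "orthogonal b (A *v v)"
      using \<open>v \<in> S\<close> \<open>b \<in> B\<close> unfolding S_def orthogonal_def by simp
  qed
  have "z \<bullet> (A *v z) \<le> (v \<bullet> (A *v v)) * (z \<bullet> z)" if "z \<in> S" for z
  proof (cases "z = 0")
    case False
    have "z /\<^sub>R norm z \<in> K"
      using False \<open>z \<in> S\<close> \<open>subspace S\<close> unfolding K_def by (simp add: subspace_scale)
    then have "(z /\<^sub>R norm z) \<bullet> (A *v (z /\<^sub>R norm z)) \<le> v \<bullet> (A *v v)"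
      by (rule vmax)
    then have "(z \<bullet> (A *v z)) / (norm z)\<^sup>2 \<le> v \<bullet> (A *v v)"
      by (simp add: matrix_vector_mult_scaleR power2_eq_square divide_inverse
          mult.commute mult.left_commute)
    then show ?thesis
      using False by (simp add: divide_le_eq power2_norm_eq_inner mult.commute)
  qed simp
  then have "A *v v = (v \<bullet> (A *v v)) *\<^sub>R v"
    by (intro quadratic_form_max_imp_eigenvector[OF sym \<open>subspace S\<close> \<open>v \<in> S\<close>
          \<open>A *v v \<in> S\<close> \<open>norm v = 1\<close>])
  then show ?thesis
    using \<open>v \<in> S\<close> \<open>norm v = 1\<close> unfolding S_def by blast
qed

lemma orthonormal_eigenvectors_card_le:
  fixes A :: "real^'n^'n"
  assumes "orthonormal_eigenvectors A B"
  shows "card B \<le> CARD('n)"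
proof -
  have "independent B"
    using assms unfolding orthonormal_eigenvectors_def
    by (intro pairwise_orthogonal_independent) auto
  then show ?thesis
    using independent_card_le[of B] by simp
qed

lemma inner_sum_orthonormal:
  fixes B :: "'a::real_inner set"
  assumes "finite B" "pairwise orthogonal B" "\<forall>b\<in>B. norm b = 1" "c \<in> B"
  shows "c \<bullet> (\<Sum>b\<in>B. k b *\<^sub>R b) = k c"
proof -
  have "c \<bullet> (\<Sum>b\<in>B. k b *\<^sub>R b) = (\<Sum>b\<in>B. k b * (c \<bullet> b))"
    by (simp add: inner_sum_right)
  also have "\<dots> = k c * (c \<bullet> c) + (\<Sum>b\<in>B - {c}. k b * (c \<bullet> b))"
    using assms(1,4) by (rule sum.remove)
  also have "(\<Sum>b\<in>B - {c}. k b * (c \<bullet> b)) = 0"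
    using assms(2,4) unfolding pairwise_def orthogonal_def by (intro sum.neutral) auto
  finally show ?thesis
    using assms(3,4) by (simp add: norm_eq_1)
qed

lemma symmetric_matrix_orthonormal_eigenbasis:
  fixes A :: "real^'n^'n"
  assumes sym: "transpose A = A"
  obtains B where "orthonormal_eigenvectors A B" "\<And>x. (\<Sum>b\<in>B. (b \<bullet> x) *\<^sub>R b) = x"
proof -
  have "orthonormal_eigenvectors A {}"
    unfolding orthonormal_eigenvectors_def by simp
  then obtain B where B: "orthonormal_eigenvectors A B"
    and maximal: "\<And>C. orthonormal_eigenvectors A C \<Longrightarrow> card C \<le> card B"
    using ex_has_greatest_nat[of "orthonormal_eigenvectors A" "{}" card "CARD('n) + 1"]
      orthonormal_eigenvectors_card_le by fastforce
  have "(\<Sum>b\<in>B. (b \<bullet> x) *\<^sub>R b) = x" for x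
  proof (rule ccontr)
    define y where "y = x - (\<Sum>b\<in>B. (b \<bullet> x) *\<^sub>R b)"
    assume "(\<Sum>b\<in>B. (b \<bullet> x) *\<^sub>R b) \<noteq> x"
    then have "y \<noteq> 0"
      unfolding y_def by simp
    moreover have "\<forall>b\<in>B. orthogonal b y"
      using B inner_sum_orthonormal[of B _ "\<lambda>b. b \<bullet> x"]
      unfolding y_def orthogonal_def orthonormal_eigenvectors_def by (simp add: inner_diff_right)
    ultimately obtain v where v: "norm v = 1" "\<forall>b\<in>B. orthogonal b v"
      "A *v v = (v \<bullet> (A *v v)) *\<^sub>R v"
      using symmetric_matrix_eigenvector_orthogonal[OF sym B] by blast
    then have "v \<notin> B"
      by (metis norm_zero orthogonal_self zero_neq_one)
    have "orthonormal_eigenvectors A (insert v B)"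
      using B v unfolding orthonormal_eigenvectors_def
      by (auto simp: pairwise_insert orthogonal_commute)
    then have "card (insert v B) \<le> card B"
      by (rule maximal)
    then show False
      using \<open>v \<notin> B\<close> B unfolding orthonormal_eigenvectors_def by simp
  qed
  then show ?thesis
    using B that by blast
qed

lemma matrix_vector_eigenbasis_expansion:
  fixes M :: "real^'n^'n"
  assumes "\<And>x. (\<Sum>b\<in>B. (b \<bullet> x) *\<^sub>R b) = x" "\<And>b. b \<in> B \<Longrightarrow> M *v b = h b *\<^sub>R b"
  shows "M *v x = (\<Sum>b\<in>B. (h b * (b \<bullet> x)) *\<^sub>R b)"
proof -
  have "M *v x = M *v (\<Sum>b\<in>B. (b \<bullet> x) *\<^sub>R b)"
    by (simp only: assms(1))
  also have "\<dots> = (\<Sum>b\<in>B. (b \<bullet> x) *\<^sub>R (M *v b))"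
    by (simp add: vec.sum matrix_vector_mult_scaleR)
  finally show ?thesis
    by (simp add: assms(2) mult.commute)
qed

lemma pos_semidef_square_root_eigenvector:
  fixes T A :: "real^'n^'n"
  assumes T: "pos_semidef T" "T ** T = A" and Ab: "A *v b = \<mu> *\<^sub>R b"
  shows "T *v b = sqrt \<mu> *\<^sub>R b"
proof (cases "b = 0")
  case False
  have sym: "transpose T = T" and psd: "\<And>x. x \<bullet> (T *v x) \<ge> 0"
    using T(1) unfolding pos_semidef_def by auto
  have TT: "T *v (T *v x) = A *v x" for x
    using T(2) by (simp add: matrix_vector_mul_assoc)
  have quad: "\<mu> * (b \<bullet> b) = (T *v b) \<bullet> (T *v b)"
    using inner_symmetric_matrix_vector[OF sym, of b "T *v b"] by (simp add: TT Ab)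
  then have "\<mu> \<ge> 0"
    using False by (metis inner_ge_zero inner_gt_zero_iff zero_le_mult_iff not_less)
  show ?thesis
  proof (cases "\<mu> = 0")
    case True
    then show ?thesis
      using quad by simp
  next
    case False
    define s where "s = sqrt \<mu>"
    define z where "z = T *v b - s *\<^sub>R b"
    have "s > 0" "s * s = \<mu>"
      unfolding s_def using False \<open>\<mu> \<ge> 0\<close> by auto
    then have "T *v z = - s *\<^sub>R z"
      unfolding z_def using TT Ab
      by (simp add: matrix_vector_mult_diff_distrib matrix_vector_mult_scaleR algebra_simps)
    then have "s * (z \<bullet> z) \<le> 0"
      using psd[of z] by simp
    then have "z \<bullet> z \<le> 0"
      using \<open>s > 0\<close> by (simp add: mult_le_0_iff)
    then have "z = 0"
      by (metis inner_eq_zero_iff inner_ge_zero order_antisym)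
    then show ?thesis
      unfolding z_def s_def by simp
  qed
qed simp

lemma pos_semidef_square_root_exists:
  fixes A :: "real^'n^'n"
  assumes "pos_semidef A"
  obtains S where "pos_semidef S" "S ** S = A"
proof -
  have sym: "transpose A = A" and psd: "\<And>x. x \<bullet> (A *v x) \<ge> 0"
    using assms unfolding pos_semidef_def by auto
  obtain B where B: "orthonormal_eigenvectors A B"
    and span: "\<And>x. (\<Sum>b\<in>B. (b \<bullet> x) *\<^sub>R b) = x"
    using symmetric_matrix_orthonormal_eigenbasis[OF sym] by blast
  define \<mu> where "\<mu> b = b \<bullet> (A *v b)" for b
  have fin: "finite B" and orth: "pairwise orthogonal B" and unit: "\<forall>b\<in>B. norm b = 1"
    and eig: "\<And>b. b \<in> B \<Longrightarrow> A *v b = \<mu> b *\<^sub>R b"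
    using B unfolding orthonormal_eigenvectors_def \<mu>_def by auto
  have \<mu>_nonneg: "\<mu> b \<ge> 0" for b
    unfolding \<mu>_def by (rule psd)
  define f where "f x = (\<Sum>b\<in>B. (sqrt (\<mu> b) * (b \<bullet> x)) *\<^sub>R b)" for x
  define S where "S = matrix f"
  have "linear f"
    unfolding f_def by (intro linear_compose_sum ballI linearI) (simp_all add: algebra_simps)
  then have Sf: "S *v x = f x" for x
    unfolding S_def by (simp add: fun_eq_iff[symmetric])
  have "(transpose S *v x) \<bullet> y = (S *v x) \<bullet> y" for x y
    by (simp add: inner_matrix_vector_transpose[symmetric] Sf f_def inner_sum_left
        inner_sum_right del: transpose_matrix_vector) (simp add: inner_commute ac_simps)
  then have "transpose S *v x = S *v x" for x
    by (metis vector_eq_rdot)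
  then have "transpose S = S"
    by (simp add: matrix_eq)
  moreover have "x \<bullet> (S *v x) \<ge> 0" for x
    unfolding Sf f_def inner_sum_right
    by (intro sum_nonneg) (simp add: inner_commute[of x] mult.assoc \<mu>_nonneg)
  moreover have "S *v (S *v x) = A *v x" for x
  proof -
    have "b \<bullet> f x = sqrt (\<mu> b) * (b \<bullet> x)" if "b \<in> B" for b
      unfolding f_def using inner_sum_orthonormal[OF fin orth unit that] .
    moreover have "A *v x = (\<Sum>b\<in>B. (\<mu> b * (b \<bullet> x)) *\<^sub>R b)"
      by (rule matrix_vector_eigenbasis_expansion[OF span eig])
    ultimately show ?thesis
      unfolding Sf by (simp add: f_def[of "f x"] mult.assoc[symmetric] \<mu>_nonneg cong: sum.cong)
  qed
  then have "S ** S = A"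
    by (simp add: matrix_eq matrix_vector_mul_assoc[symmetric])
  ultimately show ?thesis
    using that unfolding pos_semidef_def by blast
qed

lemma pos_semidef_square_root_unique:
  fixes S T A :: "real^'n^'n"
  assumes S: "pos_semidef S" "S ** S = A" and T: "pos_semidef T" "T ** T = A"
  shows "S = T"
proof -
  have "transpose A = A"
    using S unfolding pos_semidef_def by (auto simp: matrix_transpose_mul)
  then obtain B where B: "orthonormal_eigenvectors A B"
    and span: "\<And>x. (\<Sum>b\<in>B. (b \<bullet> x) *\<^sub>R b) = x"
    using symmetric_matrix_orthonormal_eigenbasis by blast
  have "A *v b = (b \<bullet> (A *v b)) *\<^sub>R b" if "b \<in> B" for b
    using B that unfolding orthonormal_eigenvectors_def by blast
  then have S_eig: "S *v b = sqrt (b \<bullet> (A *v b)) *\<^sub>R b"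
    and T_eig: "T *v b = sqrt (b \<bullet> (A *v b)) *\<^sub>R b" if "b \<in> B" for b
    using pos_semidef_square_root_eigenvector[OF S] pos_semidef_square_root_eigenvector[OF T] that
    by blast+
  have "S *v x = T *v x" for x
  proof -
    have "S *v x = (\<Sum>b\<in>B. (sqrt (b \<bullet> (A *v b)) * (b \<bullet> x)) *\<^sub>R b)"
      by (rule matrix_vector_eigenbasis_expansion[OF span S_eig])
    also have "\<dots> = T *v x"
      by (rule matrix_vector_eigenbasis_expansion[OF span T_eig, symmetric])
    finally show ?thesis .
  qed
  then show ?thesis
    by (simp add: matrix_eq)
qed

lemma pos_semidef_square_root_ex1:
  fixes A :: "real^'n^'n"
  assumes "pos_semidef A"
  shows "\<exists>!S. pos_semidef S \<and> S ** S = A"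
proof -
  obtain S where "pos_semidef S" "S ** S = A"
    using pos_semidef_square_root_exists[OF assms] .
  then show ?thesis
    using pos_semidef_square_root_unique by blast
qed

lemma pos_semidef_msqrt:
  fixes A :: "real^'n^'n"
  assumes "pos_semidef A"
  shows "pos_semidef (msqrt A)"
  using theI'[OF pos_semidef_square_root_ex1[OF assms]] unfolding msqrt_def by blast

lemma msqrt_square:
  fixes A :: "real^'n^'n"
  assumes "pos_semidef A"
  shows "msqrt A ** msqrt A = A"
  using theI'[OF pos_semidef_square_root_ex1[OF assms]] unfolding msqrt_def by blast

lemma symmetric_msqrt:
  fixes A :: "real^'n^'n"
  assumes "pos_semidef A"
  shows "transpose (msqrt A) = msqrt A"
  using pos_semidef_msqrt[OF assms] unfolding pos_semidef_def by blast

lemma invertible_msqrt: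
  fixes A :: "real^'n^'n"
  assumes "pos_semidef A" "invertible A"
  shows "invertible (msqrt A)"
  using assms invertible_mult_left_factor msqrt_square by metis

lemma symmetric_matrix_inv_msqrt:
  fixes A :: "real^'n^'n"
  assumes "pos_semidef A" "invertible A"
  shows "transpose (matrix_inv (msqrt A)) = matrix_inv (msqrt A)"
  by (intro symmetric_matrix_inv invertible_msqrt symmetric_msqrt assms)

lemma matrix_inv_eq_square_matrix_inv_msqrt:
  fixes A :: "real^'n^'n"
  assumes "pos_semidef A" "invertible A"
  shows "matrix_inv A = matrix_inv (msqrt A) ** matrix_inv (msqrt A)"
  using matrix_inv_mult[OF invertible_msqrt[OF assms] invertible_msqrt[OF assms]]
  by (simp add: msqrt_square[OF assms(1)])

section \<open>Weighted norms\<close>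

lemma mnorm_symmetric_square:
  fixes S :: "real^'n^'n"
  assumes "transpose S = S"
  shows "mnorm (S ** S) x = norm (S *v x)"
  unfolding mnorm_def norm_eq_sqrt_inner
  by (simp add: matrix_vector_mul_assoc[symmetric] inner_symmetric_matrix_vector[OF assms])

lemma mnorm_eq_norm_msqrt:
  fixes A :: "real^'n^'n"
  assumes "pos_semidef A"
  shows "mnorm A x = norm (msqrt A *v x)"
  using mnorm_symmetric_square[OF symmetric_msqrt[OF assms]] by (simp add: msqrt_square[OF assms])

lemma mnorm_matrix_inv_eq_norm:
  fixes A :: "real^'n^'n"
  assumes "pos_semidef A" "invertible A"
  shows "mnorm (matrix_inv A) x = norm (matrix_inv (msqrt A) *v x)"
  using mnorm_symmetric_square[OF symmetric_matrix_inv_msqrt[OF assms]]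
  by (simp add: matrix_inv_eq_square_matrix_inv_msqrt[OF assms])

lemma mnorm_scaleR:
  fixes M :: "real^'n^'n"
  shows "mnorm M (c *\<^sub>R x) = \<bar>c\<bar> * mnorm M x"
proof -
  have "(c *\<^sub>R x) \<bullet> (M *v (c *\<^sub>R x)) = c\<^sup>2 * (x \<bullet> (M *v x))"
    by (simp add: matrix_vector_mult_scaleR power2_eq_square)
  then show ?thesis
    by (simp add: mnorm_def real_sqrt_mult)
qed

lemma norm_transpose_matrix_vector_le:
  fixes M :: "real^'n^'m"
  shows "norm (transpose M *v y) \<le> onorm ((*v) M) * norm y"
proof -
  define z where "z = transpose M *v y"
  have "(norm z)\<^sup>2 = y \<bullet> (M *v z)"
    unfolding z_def power2_norm_eq_inner
    by (simp add: inner_matrix_vector_transpose del: transpose_matrix_vector)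
  also have "\<dots> \<le> norm y * norm (M *v z)"
    by (rule norm_cauchy_schwarz)
  also have "\<dots> \<le> norm y * (onorm ((*v) M) * norm z)"
    by (intro mult_left_mono onorm matrix_vector_mul_bounded_linear) simp
  finally have "norm z * norm z \<le> (onorm ((*v) M) * norm y) * norm z"
    by (simp add: power2_eq_square algebra_simps)
  then show ?thesis
    unfolding z_def
    using onorm_pos_le[OF matrix_vector_mul_bounded_linear, of M]
    by (cases "norm z = 0") (simp_all add: z_def)
qed

lemma norm_matrix_vector_le_onorm_mnorm:
  fixes M :: "real^'n^'m" and H :: "real^'n^'n"
  assumes "pos_semidef H" "invertible H"
  shows "norm (M *v x) \<le> onorm ((*v) (M ** matrix_inv (msqrt H))) * mnorm H x"
proof -
  have "M *v x = (M ** matrix_inv (msqrt H)) *v (msqrt H *v x)"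
    by (simp add: matrix_vector_mul_assoc[symmetric] matrix_inv_cancel_left invertible_msqrt assms)
  then show ?thesis
    using onorm[OF matrix_vector_mul_bounded_linear, of "M ** matrix_inv (msqrt H)" "msqrt H *v x"]
    by (simp add: mnorm_eq_norm_msqrt[OF assms(1)])
qed

lemma mnorm_matrix_inv_transpose_le:
  fixes E :: "real^'n^'m" and H :: "real^'n^'n" and W :: "real^'m^'m"
  assumes H: "pos_semidef H" "invertible H" and W: "pos_semidef W" "invertible W"
  shows "mnorm (matrix_inv H) (transpose E *v y)
           \<le> onorm ((*v) (matrix_inv (msqrt W) ** E ** matrix_inv (msqrt H))) * mnorm W y"
proof -
  let ?Ri = "matrix_inv (msqrt H)" and ?Qi = "matrix_inv (msqrt W)"
  have "transpose (?Qi ** E ** ?Ri) *v (msqrt W *v y)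
          = ?Ri *v (transpose E *v (?Qi *v (msqrt W *v y)))"
    by (simp only: matrix_transpose_mul symmetric_matrix_inv_msqrt H W matrix_vector_mul_assoc
        matrix_mul_assoc)
  also have "\<dots> = ?Ri *v (transpose E *v y)"
    by (simp only: matrix_inv_cancel_left invertible_msqrt W)
  finally have "mnorm (matrix_inv H) (transpose E *v y)
                  = norm (transpose (?Qi ** E ** ?Ri) *v (msqrt W *v y))"
    by (simp add: mnorm_matrix_inv_eq_norm[OF H])
  also have "\<dots> \<le> onorm ((*v) (?Qi ** E ** ?Ri)) * norm (msqrt W *v y)"
    by (rule norm_transpose_matrix_vector_le)
  finally show ?thesis
    by (simp add: mnorm_eq_norm_msqrt[OF W(1)])
qed

lemma norm_projection_eq:
  fixes G :: "real^'n^'m" and H :: "real^'n^'n" and W :: "real^'m^'m"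
  assumes H: "pos_semidef H" "invertible H"
    and W_def: "W = G ** matrix_inv H ** transpose G" and "invertible W"
  shows "norm ((matrix_inv (msqrt H) ** transpose G ** matrix_inv W ** G ** matrix_inv (msqrt H))
                 *v z)
           = norm (matrix_inv (msqrt W) *v (G *v (matrix_inv (msqrt H) *v z)))"
proof -
  let ?Qi = "matrix_inv (msqrt W)"
  define y where "y = ?Qi *v (G *v (matrix_inv (msqrt H) *v z))"
  have "pos_semidef W"
    unfolding W_def by (intro pos_semidef_congruence pos_semidef_matrix_inv H)
  note W = this \<open>invertible W\<close>
  have "(matrix_inv (msqrt H) ** transpose G ** matrix_inv W ** G ** matrix_inv (msqrt H)) *v z
          = matrix_inv (msqrt H) *v (transpose G *v (?Qi *v y))"
    unfolding y_def matrix_inv_eq_square_matrix_inv_msqrt[OF W]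
    by (simp only: matrix_vector_mul_assoc matrix_mul_assoc)
  also have "norm \<dots> = mnorm (matrix_inv H) (transpose G *v (?Qi *v y))"
    by (simp add: mnorm_matrix_inv_eq_norm[OF H])
  also have "\<dots> = mnorm W (?Qi *v y)"
    unfolding mnorm_def W_def
    by (simp add: inner_matrix_vector_transpose matrix_vector_mul_assoc[symmetric]
        del: transpose_matrix_vector)
  also have "\<dots> = norm y"
    by (simp add: mnorm_eq_norm_msqrt[OF W(1)] matrix_inv_cancel_right invertible_msqrt W)
  finally show ?thesis
    unfolding y_def .
qed

section \<open>Linearisation estimates\<close>

lemma norm_remainder_le_of_lipschitz_derivative:
  fixes f f' :: "real \<Rightarrow> 'a::real_inner"
  assumes deriv: "\<And>t. 0 \<le> t \<Longrightarrow> t \<le> 1 \<Longrightarrow> (f has_vector_derivative f' t) (at t)"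
    and lip: "\<And>t. 0 \<le> t \<Longrightarrow> t \<le> 1 \<Longrightarrow> norm (f' t - f' 0) \<le> K * t"
  shows "norm (f 1 - f 0 - f' 0) \<le> K / 2"
proof (cases "f 1 - f 0 - f' 0 = 0")
  case True
  then show ?thesis
    using order_trans[OF norm_ge_zero lip[of 1]] by simp
next
  case False
  define u where "u = (f 1 - f 0 - f' 0) /\<^sub>R norm (f 1 - f 0 - f' 0)"
  define s where "s t = u \<bullet> (f t - t *\<^sub>R f' 0) - K / 2 * t\<^sup>2" for t
  have "norm u = 1"
    unfolding u_def using False by simp
  have "s 1 \<le> s 0"
  proof (rule DERIV_nonpos_imp_nonincreasing[of 0 1 s])
    fix t :: real
    assume t: "0 \<le> t" "t \<le> 1"
    have "(s has_real_derivative u \<bullet> (f' t - f' 0) - K * t) (at t)"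
      using deriv[OF t] unfolding s_def has_vector_derivative_def
      by (auto intro!: derivative_eq_intros
          simp: has_field_derivative_def algebra_simps inner_diff_right)
    moreover have "u \<bullet> (f' t - f' 0) \<le> K * t"
      using norm_cauchy_schwarz[of u "f' t - f' 0"] lip[OF t] \<open>norm u = 1\<close> by simp
    ultimately show "\<exists>y. (s has_real_derivative y) (at t) \<and> y \<le> 0"
      by (intro exI conjI) auto
  qed simp
  moreover have "u \<bullet> (f 1 - f 0 - f' 0) = norm (f 1 - f 0 - f' 0)"
    unfolding u_def using False by (simp add: dot_square_norm power2_eq_square)
  ultimately show ?thesis
    unfolding s_def by (simp add: inner_diff_right)
qed

lemma kkt_difference_decomposition:
  fixes G G' :: "real^'n^'m" and H :: "real^'n^'n" and W :: "real^'m^'m"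
  assumes H: "pos_semidef H" "invertible H" and W: "pos_semidef W" "invertible W"
    and curvature: "mnorm (matrix_inv H) (transpose (G' - G) *v lam - H *v \<delta>) \<le> a"
    and lipschitz: "onorm ((*v) (matrix_inv (msqrt W) ** (G' - G) ** matrix_inv (msqrt H))) \<le> b"
  shows "\<exists>\<Delta>. transpose G' *v lam' - transpose G *v lam = H *v \<delta> + transpose G *v (lam' - lam) + \<Delta>
              \<and> mnorm (matrix_inv H) \<Delta> \<le> a + b * mnorm W (lam' - lam)"
proof -
  define \<Delta>\<^sub>1 where "\<Delta>\<^sub>1 = transpose (G' - G) *v lam - H *v \<delta>"
  define \<Delta>\<^sub>2 where "\<Delta>\<^sub>2 = transpose (G' - G) *v (lam' - lam)"
  have "transpose G' *v lam' - transpose G *v lam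
          = H *v \<delta> + transpose G *v (lam' - lam) + (\<Delta>\<^sub>1 + \<Delta>\<^sub>2)"
    unfolding \<Delta>\<^sub>1_def \<Delta>\<^sub>2_def
    by (simp add: vector_matrix_mult_diff_rdistrib vector_matrix_mult_diff_distrib algebra_simps)
  moreover have "mnorm (matrix_inv H) (\<Delta>\<^sub>1 + \<Delta>\<^sub>2)
                   \<le> mnorm (matrix_inv H) \<Delta>\<^sub>1 + mnorm (matrix_inv H) \<Delta>\<^sub>2"
    by (simp add: mnorm_matrix_inv_eq_norm H matrix_vector_right_distrib norm_triangle_ineq)
  moreover have "mnorm (matrix_inv H) \<Delta>\<^sub>2 \<le> b * mnorm W (lam' - lam)"
  proof -
    have "mnorm (matrix_inv H) \<Delta>\<^sub>2
            \<le> onorm ((*v) (matrix_inv (msqrt W) ** (G' - G) ** matrix_inv (msqrt H)))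
               * mnorm W (lam' - lam)"
      unfolding \<Delta>\<^sub>2_def by (rule mnorm_matrix_inv_transpose_le[OF H W])
    also have "\<dots> \<le> b * mnorm W (lam' - lam)"
      by (intro mult_right_mono lipschitz) (simp add: mnorm_eq_norm_msqrt[OF W(1)])
    finally show ?thesis .
  qed
  moreover have "mnorm (matrix_inv H) \<Delta>\<^sub>1 \<le> a"
    unfolding \<Delta>\<^sub>1_def by (rule curvature)
  ultimately show ?thesis
    by (intro exI[of _ "\<Delta>\<^sub>1 + \<Delta>\<^sub>2"] conjI) auto
qed

lemma norm_projected_step_le:
  fixes g :: "real^'n \<Rightarrow> real^'m" and Dg :: "real^'n \<Rightarrow> real^'n^'m"
    and H :: "real^'n^'n" and W :: "real^'m^'m"
  assumes jacobian: "\<And>x. (g has_derivative (\<lambda>h. Dg x *v h)) (at x)"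
    and H: "pos_semidef H" "invertible H"
    and W_def: "W = Dg x\<^sub>0 ** matrix_inv H ** transpose (Dg x\<^sub>0)" and "invertible W"
    and "g x\<^sub>1 = g x\<^sub>0"
    and lipschitz: "\<And>x. onorm ((*v) (matrix_inv (msqrt W) ** (Dg x - Dg x\<^sub>0)
                                     ** matrix_inv (msqrt H)))
                          \<le> L * mnorm H (x - x\<^sub>0)"
  shows "norm ((matrix_inv (msqrt H) ** transpose (Dg x\<^sub>0) ** matrix_inv W ** Dg x\<^sub>0
                  ** matrix_inv (msqrt H)) *v (msqrt H *v (x\<^sub>1 - x\<^sub>0)))
           \<le> L / 2 * (mnorm H (x\<^sub>1 - x\<^sub>0))\<^sup>2"
proof -
  let ?Qi = "matrix_inv (msqrt W)"
  define \<delta> where "\<delta> = x\<^sub>1 - x\<^sub>0"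
  define f where "f t = ?Qi *v g (x\<^sub>0 + t *\<^sub>R \<delta>)" for t
  define f' where "f' t = ?Qi *v (Dg (x\<^sub>0 + t *\<^sub>R \<delta>) *v \<delta>)" for t
  have "(f has_vector_derivative f' t) (at t)" for t
  proof -
    have "((\<lambda>t. g (x\<^sub>0 + t *\<^sub>R \<delta>)) has_derivative (\<lambda>h. Dg (x\<^sub>0 + t *\<^sub>R \<delta>) *v (h *\<^sub>R \<delta>))) (at t)"
      by (rule has_derivative_compose[OF _ jacobian]) (auto intro!: derivative_eq_intros)
    from has_derivative_compose[OF this bounded_linear.has_derivative[OF
          matrix_vector_mul_bounded_linear has_derivative_ident]]
    show ?thesis
      unfolding f_def f'_def has_vector_derivative_def
      by (simp add: o_def matrix_vector_mult_scaleR)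
  qed
  moreover have "norm (f' t - f' 0) \<le> L * (mnorm H \<delta>)\<^sup>2 * t" if "0 \<le> t" for t
  proof -
    have "norm (f' t - f' 0) = norm ((?Qi ** (Dg (x\<^sub>0 + t *\<^sub>R \<delta>) - Dg x\<^sub>0)) *v \<delta>)"
      unfolding f'_def
      by (simp add: matrix_vector_mul_assoc[symmetric] matrix_vector_mult_diff_rdistrib
          matrix_vector_mult_diff_distrib)
    also have "\<dots> \<le> onorm ((*v) (?Qi ** (Dg (x\<^sub>0 + t *\<^sub>R \<delta>) - Dg x\<^sub>0) ** matrix_inv (msqrt H)))
                    * mnorm H \<delta>"
      by (rule norm_matrix_vector_le_onorm_mnorm[OF H])
    also have "\<dots> \<le> L * mnorm H (t *\<^sub>R \<delta>) * mnorm H \<delta>"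
      using lipschitz[of "x\<^sub>0 + t *\<^sub>R \<delta>"]
      by (intro mult_right_mono) (simp_all add: mnorm_eq_norm_msqrt[OF H(1)])
    finally show ?thesis
      using that by (simp add: mnorm_scaleR power2_eq_square mult_ac)
  qed
  ultimately have "norm (f 1 - f 0 - f' 0) \<le> L * (mnorm H \<delta>)\<^sup>2 / 2"
    by (intro norm_remainder_le_of_lipschitz_derivative) auto
  moreover have "f 1 - f 0 - f' 0 = - (?Qi *v (Dg x\<^sub>0 *v \<delta>))"
    unfolding f_def f'_def \<delta>_def using \<open>g x\<^sub>1 = g x\<^sub>0\<close> by simp
  ultimately show ?thesis
    unfolding \<delta>_def
    by (simp add: norm_projection_eq[OF H W_def \<open>invertible W\<close>] matrix_inv_cancel_left
        invertible_msqrt H)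
qed

theorem lemma5:
  fixes g :: "real^'d \<Rightarrow> real^'m"
    and Dg :: "real^'d \<Rightarrow> real^'d^'m"
    and Hg :: "'m \<Rightarrow> real^'d \<Rightarrow> real^'d^'d"
    and w_star w phi_star phi :: "real^'d"
    and lam_star lam :: "real^'m"
    and H :: "real^'d^'d" and W :: "real^'m^'m" and P_G :: "real^'d^'d"
    and L :: real
  assumes m_le_d: "CARD('m) \<le> CARD('d)"
    and strongly_convex: "\<And>i. strongly_convex (\<lambda>x. g x $ i)"
    and jacobian: "\<And>x. (g has_derivative (\<lambda>h. Dg x *v h)) (at x)"
    and hessian: "\<And>i x. ((\<lambda>y. Dg y $ i) has_derivative (\<lambda>h. Hg i x *v h)) (at x)"
    and phi_star_max: "g phi_star \<le> 0" "\<And>x. g x \<le> 0 \<Longrightarrow> x \<bullet> w_star \<le> phi_star \<bullet> w_star"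
    and phi_max: "g phi \<le> 0" "\<And>x. g x \<le> 0 \<Longrightarrow> x \<bullet> w \<le> phi \<bullet> w"
    and active: "g phi_star = 0" "g phi = 0"
    and lam_nonneg: "lam_star \<ge> 0" "lam \<ge> 0"
    and kkt_star: "w_star = transpose (Dg phi_star) *v lam_star"
    and kkt: "w = transpose (Dg phi) *v lam"
    and H_def: "H = (\<Sum>i\<in>UNIV. lam_star $ i *\<^sub>R Hg i phi_star)"
    and H_pd: "pos_def H"
    and W_def: "W = Dg phi_star ** matrix_inv H ** transpose (Dg phi_star)"
    and W_inv: "invertible W"
    and P_G_def: "P_G = matrix_inv (msqrt H) ** transpose (Dg phi_star) ** matrix_inv W
                        ** Dg phi_star ** matrix_inv (msqrt H)"
    and S1: "mnorm (matrix_inv H)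
               (transpose (Dg phi - Dg phi_star) *v lam_star - H *v (phi - phi_star))
             \<le> 1/4 * mnorm H (phi - phi_star)"
    and L_pos: "L > 0"
    and S2: "\<And>x. onorm (\<lambda>v. (matrix_inv (msqrt W) ** (Dg x - Dg phi_star) ** matrix_inv (msqrt H)) *v v)
                  \<le> L * mnorm H (x - phi_star)"
  shows "(\<exists>\<Delta>. w - w_star = H *v (phi - phi_star) + transpose (Dg phi_star) *v (lam - lam_star) + \<Delta>
              \<and> mnorm (matrix_inv H) \<Delta>
                  \<le> 1/4 * mnorm H (phi - phi_star) + L * mnorm H (phi - phi_star) * mnorm W (lam - lam_star))
         \<and> norm (P_G *v (msqrt H *v (phi - phi_star))) \<le> L / 2 * (mnorm H (phi - phi_star))\<^sup>2"
proof -
  have H: "pos_semidef H" "invertible H"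
    using H_pd by (simp_all add: pos_def_imp_pos_semidef pos_def_imp_invertible)
  have "pos_semidef W"
    unfolding W_def by (intro pos_semidef_congruence pos_semidef_matrix_inv H)
  note W = this W_inv
  show ?thesis
    unfolding kkt kkt_star P_G_def
    by (intro conjI kkt_difference_decomposition[OF H W S1 S2]
        norm_projected_step_le[OF jacobian H W_def W_inv _ S2]) (simp add: active)
qed

end
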